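(* Let $g:[0,\infty)\to\mathbb{R}$ be continuous and bounded and let $\varepsilon>0$. For any $\lambda\le 0$ there is only one solution $u$ of $$\varepsilon^2u''=u^3-\lambda u+g(t)\quad (t\ge 0),\qquad u'(0)=0,$$ (with $u(0)=\alpha\in\mathbb{R}$ arbitrary) which is bounded on $[0,\infty)$. *)

theory Defs
  imports "HOL-Analysis.Analysis"
begin

text \<open>
  Classical solutions on \<open>[0, \<infinity>)\<close>; derivatives are taken within the half-line, hence one-sided
  at \<open>0\<close>. The initial value \<open>u 0\<close> is not prescribed.
\<close>

definition neumann_solution ::
  "real \<Rightarrow> real \<Rightarrow> (real \<Rightarrow> real) \<Rightarrow> (real \<Rightarrow> real) \<Rightarrow> bool" where
  "neumann_solution \<epsilon> lam g u \<longleftrightarrow>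
    (\<exists>v w.
      (\<forall>t\<ge>0. (u has_real_derivative v t) (at t within {0..})) \<and>
      (\<forall>t\<ge>0. (v has_real_derivative w t) (at t within {0..})) \<and>
      (\<forall>t\<ge>0. \<epsilon>\<^sup>2 * w t = (u t) ^ 3 - lam * u t + g t) \<and>
      v 0 = 0)"

end

theory Submission
  imports Defs
begin

text \<open>
  Uniqueness: for the difference \<open>z\<close> of two bounded solutions, \<open>z z'\<close> vanishes at \<open>0\<close> and is
  nondecreasing because \<open>x\<^sup>3 - \<lambda> x\<close> is; as \<open>z\<^sup>2\<close> stays bounded, \<open>z z' = 0\<close>,
  and its derivative \<open>z'\<^sup>2 + z z''\<close> vanishes only where \<open>z = 0\<close>.

  Existence: for \<open>M\<close> with \<open>M\<^sup>3 - \<lambda> M \<ge> sup \<bar>g\<bar>\<close> the constants \<open>- M\<close> and \<open>M\<close> are a sub- and a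
  supersolution. For \<open>K\<close> large, \<open>x \<mapsto> K x - x\<^sup>3 + \<lambda> x\<close> is nondecreasing on \<open>[- M, M]\<close>, so the
  iteration that solves \<open>\<epsilon>\<^sup>2 v'' - K v = - (K u - u\<^sup>3 + \<lambda> u - g)\<close>, \<open>v'(0) = 0\<close>, \<open>v\<close> bounded,
  increases from \<open>- M\<close>. It stays below \<open>M\<close>, and by dominated convergence its limit is a fixed
  point. (For \<open>\<lambda> = 0\<close> this map need not be a strict contraction.)
\<close>

section \<open>Uniqueness of the bounded solution\<close>

text \<open>Inside the half-line the one-sided derivative is the usual one; the endpoint
  \<open>0\<close> needs only continuity. The sign is asked for from \<open>a\<close> on, so that
  growth can be tracked from a later time.\<close>

lemma mono_half_line:
  fixes f :: "real \<Rightarrow> real"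
  assumes der: "\<And>t. t \<ge> 0 \<Longrightarrow> (f has_real_derivative f' t) (at t within {0..})"
    and nonneg: "\<And>t. t \<ge> a \<Longrightarrow> f' t \<ge> 0"
    and ab: "0 \<le> a" "a \<le> b"
  shows "f a \<le> f b"
proof (rule DERIV_nonneg_imp_increasing_open[OF \<open>a \<le> b\<close>])
  fix x assume x: "a < x" "x < b"
  then have "at x within {0..} = at x"
    using ab by (intro at_within_interior) auto
  then show "\<exists>y. DERIV f x :> y \<and> 0 \<le> y"
    using der[of x] nonneg[of x] x ab by auto
next
  have "continuous_on {0..} f"
    by (rule DERIV_continuous_on) (use der in auto)
  then show "continuous_on {a..b} f"
    by (rule continuous_on_subset) (use ab in auto)
qed

lemma bounded_convex_square_zero:
  fixes z v w :: "real \<Rightarrow> real"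
  assumes z: "\<And>t. t \<ge> 0 \<Longrightarrow> (z has_real_derivative v t) (at t within {0..})"
    and v: "\<And>t. t \<ge> 0 \<Longrightarrow> (v has_real_derivative w t) (at t within {0..})"
    and v0: "v 0 = 0"
    and zw: "\<And>t. t \<ge> 0 \<Longrightarrow> z t * w t \<ge> 0"
    and bd: "\<And>t. t \<ge> 0 \<Longrightarrow> \<bar>z t\<bar> \<le> C"
    and t: "t \<ge> 0"
  shows "z t * w t = 0"
proof -
  define p where "p t = z t * v t" for t
  have p: "(p has_real_derivative (v t)\<^sup>2 + z t * w t) (at t within {0..})" if "t \<ge> 0" for t
    unfolding p_def
    by (rule derivative_eq_intros z v that)+ (simp add: power2_eq_square)
  have z2: "((\<lambda>t. (z t)\<^sup>2) has_real_derivative 2 * p t) (at t within {0..})" if "t \<ge> 0" for t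
    unfolding p_def
    by (rule derivative_eq_intros z that refl)+ (simp add: that)
  have pmono: "p a \<le> p b" if "0 \<le> a" "a \<le> b" for a b
    by (rule mono_half_line[OF p _ that]) (use zw that in auto)
  have p_zero: "p s = 0" if s: "s \<ge> 0" for s
  proof (rule ccontr)
    assume "p s \<noteq> 0"
    then have pos: "p s > 0" using pmono[of 0 s] s by (simp add: p_def[of 0] v0)
    \<comment> \<open>\<open>b\<close> is chosen so that the linear lower bound
      \<open>2 * p s * (b - s)\<close> for \<open>(z b)\<^sup>2\<close> equals
      \<open>C\<^sup>2 + 1\<close>, more than boundedness allows.\<close>
    define b where "b = s + (C\<^sup>2 + 1) / (2 * p s)"
    have b: "s \<le> b" using pos by (simp add: b_def)
    have "((\<lambda>t. (z t)\<^sup>2 - 2 * p s * t) has_real_derivative 2 * p t - 2 * p s)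
        (at t within {0..})" if "t \<ge> 0" for t
      by (rule derivative_eq_intros z2 that refl)+ simp
    then have "(z s)\<^sup>2 - 2 * p s * s \<le> (z b)\<^sup>2 - 2 * p s * b"
      by (rule mono_half_line) (use pmono s b in auto)
    then have "(z b)\<^sup>2 \<ge> 2 * p s * (b - s)"
      using zero_le_power2[of "z s"] unfolding right_diff_distrib by linarith
    also have "2 * p s * (b - s) = C\<^sup>2 + 1"
      using pos by (simp add: b_def)
    finally have "C\<^sup>2 + 1 \<le> (z b)\<^sup>2" .
    moreover have "(z b)\<^sup>2 \<le> C\<^sup>2"
      using bd[of b] b s by (intro abs_le_square_iff[THEN iffD1]) auto
    ultimately show False by simp
  qed
  \<comment> \<open>As \<open>p\<close> vanishes on the half-line, its derivative must be 0, also at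
    the endpoint; both summands of that derivative are nonnegative.\<close>
  have "((\<lambda>_. 0) has_real_derivative (v t)\<^sup>2 + z t * w t) (at t within {0..})"
    by (rule has_field_derivative_transform_within[OF p[OF t] zero_less_one]) (use t p_zero in auto)
  moreover have "((\<lambda>_. 0::real) has_real_derivative 0) (at t within {0..})"
    by simp
  moreover have "at t within {0..} \<noteq> bot"
    using t by (metis at_within_Ici_at_right at_within_interior atLeast_iff greaterThan_iff
        interior_real_atLeast order_le_less trivial_limit_at trivial_limit_at_right_real)
  ultimately have "(v t)\<^sup>2 + z t * w t = 0"
    by (metis has_real_derivative_iff_has_vector_derivative vector_derivative_unique_within)
  then show ?thesis
    using zw[OF t] zero_le_power2[of "v t"] by linarith
qed

text \<open>Factor out \<open>x - y\<close>; twice the cofactor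
  \<open>x\<^sup>2 + x * y + y\<^sup>2\<close> is a sum of squares. The equality case supplies the
  strictness that the linear term lacks when \<open>lam = 0\<close>.\<close>

lemma mult_diff_cubes_nonneg:
  fixes x y :: real
  shows "(x - y) * (x ^ 3 - y ^ 3) \<ge> 0" and "(x - y) * (x ^ 3 - y ^ 3) = 0 \<Longrightarrow> x = y"
proof -
  have eq: "(x - y) * (x ^ 3 - y ^ 3) = (x - y)\<^sup>2 * (x\<^sup>2 + y\<^sup>2 + (x + y)\<^sup>2) / 2"
    by (simp add: power2_eq_square power3_eq_cube algebra_simps)
  show "(x - y) * (x ^ 3 - y ^ 3) \<ge> 0"
    unfolding eq by simp
  assume "(x - y) * (x ^ 3 - y ^ 3) = 0"
  then have "x = y \<or> x\<^sup>2 + y\<^sup>2 + (x + y)\<^sup>2 = 0"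
    unfolding eq by auto
  then show "x = y"
  proof
    assume "x\<^sup>2 + y\<^sup>2 + (x + y)\<^sup>2 = 0"
    moreover have "x\<^sup>2 \<ge> 0" "y\<^sup>2 \<ge> 0" "(x + y)\<^sup>2 \<ge> 0" by simp_all
    ultimately have "x\<^sup>2 = 0" "y\<^sup>2 = 0" by linarith+
    then show "x = y" by simp
  qed
qed

lemma neumann_solution_bounded_unique:
  assumes eps: "\<epsilon> > 0" and lam: "lam \<le> 0"
    and u: "neumann_solution \<epsilon> lam g u" "bounded (u ` {0..})"
    and y: "neumann_solution \<epsilon> lam g y" "bounded (y ` {0..})"
    and t: "t \<ge> 0"
  shows "u t = y t"
proof -
  obtain v w where vw:
    "\<And>t. t \<ge> 0 \<Longrightarrow> (u has_real_derivative v t) (at t within {0..})"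
    "\<And>t. t \<ge> 0 \<Longrightarrow> (v has_real_derivative w t) (at t within {0..})"
    "\<And>t. t \<ge> 0 \<Longrightarrow> \<epsilon>\<^sup>2 * w t = (u t) ^ 3 - lam * u t + g t" "v 0 = 0"
    using u(1) unfolding neumann_solution_def by blast
  obtain v' w' where vw':
    "\<And>t. t \<ge> 0 \<Longrightarrow> (y has_real_derivative v' t) (at t within {0..})"
    "\<And>t. t \<ge> 0 \<Longrightarrow> (v' has_real_derivative w' t) (at t within {0..})"
    "\<And>t. t \<ge> 0 \<Longrightarrow> \<epsilon>\<^sup>2 * w' t = (y t) ^ 3 - lam * y t + g t" "v' 0 = 0"
    using y(1) unfolding neumann_solution_def by blast
  \<comment> \<open>Subtract the two equations, so that \<open>g\<close> cancels, and multiply by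
    \<open>u s - y s\<close>.\<close>
  have eq: "\<epsilon>\<^sup>2 * ((u s - y s) * (w s - w' s))
      = (u s - y s) * (u s ^ 3 - y s ^ 3) + (- lam) * (u s - y s)\<^sup>2" if "s \<ge> 0" for s
  proof -
    have "\<epsilon>\<^sup>2 * ((u s - y s) * (w s - w' s)) = (u s - y s) * (\<epsilon>\<^sup>2 * w s - \<epsilon>\<^sup>2 * w' s)"
      by (simp add: algebra_simps)
    then show ?thesis
      unfolding vw(3)[OF that] vw'(3)[OF that] by (simp add: algebra_simps power2_eq_square)
  qed
  have nonneg: "(u s - y s) * (w s - w' s) \<ge> 0" if "s \<ge> 0" for s
  proof -
    have "\<epsilon>\<^sup>2 * ((u s - y s) * (w s - w' s)) \<ge> 0"
      unfolding eq[OF that] using lam mult_diff_cubes_nonneg(1)[of "u s" "y s"]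
      by (intro add_nonneg_nonneg mult_nonneg_nonneg[of "- lam"]) auto
    then show ?thesis using eps by (simp add: zero_le_mult_iff)
  qed
  obtain A B where AB: "\<And>s. s \<ge> 0 \<Longrightarrow> \<bar>u s\<bar> \<le> A" "\<And>s. s \<ge> 0 \<Longrightarrow> \<bar>y s\<bar> \<le> B"
    using u(2) y(2) unfolding bounded_iff by auto
  have bd: "\<bar>u s - y s\<bar> \<le> A + B" if "s \<ge> 0" for s
    using AB[OF that] by linarith
  have "(u t - y t) * (w t - w' t) = 0"
    by (rule bounded_convex_square_zero[where z = "\<lambda>s. u s - y s" and v = "\<lambda>s. v s - v' s"
            and w = "\<lambda>s. w s - w' s" and C = "A + B"])
      (use vw vw' nonneg bd t in \<open>auto intro!: derivative_intros\<close>)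
  then have "(u t - y t) * (u t ^ 3 - y t ^ 3) + (- lam) * (u t - y t)\<^sup>2 = 0"
    using eq[OF t] by (simp only: mult_zero_right)
  moreover have "(- lam) * (u t - y t)\<^sup>2 \<ge> 0"
    using lam by (intro mult_nonneg_nonneg) auto
  ultimately have "(u t - y t) * (u t ^ 3 - y t ^ 3) = 0"
    using mult_diff_cubes_nonneg(1)[of "u t" "y t"] by linarith
  then show ?thesis by (rule mult_diff_cubes_nonneg(2))
qed

section \<open>The Green operator of the linear Neumann problem\<close>

text \<open>Measurability instead of continuity, because the pointwise limit of the iteration is at
  first known only to be measurable.\<close>

definition bounded_measurable :: "(real \<Rightarrow> real) \<Rightarrow> bool" where
  "bounded_measurable h \<longleftrightarrow> h \<in> borel_measurable (lebesgue_on {0..}) \<and> bounded (h ` {0..})"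

text \<open>
  The integral of \<open>(exp (- k \<bar>t - s\<bar>) + exp (- k (t + s))) h(s) / (2 k)\<close> over \<open>s \<ge> 0\<close>, i.e. the
  bounded solution of \<open>v'' = k\<^sup>2 v - h\<close>, \<open>v'(0) = 0\<close>. The kernel is split so that the derivatives
  reduce to the fundamental theorem of calculus.
\<close>
definition green :: "real \<Rightarrow> (real \<Rightarrow> real) \<Rightarrow> real \<Rightarrow> real" where
  "green k h t =
    (exp (- k * t) * (integral {0..} (\<lambda>s. exp (- k * s) * h s)
        + integral {0..t} (\<lambda>s. exp (k * s) * h s))
     + exp (k * t) * (integral {0..} (\<lambda>s. exp (- k * s) * h s)
        - integral {0..t} (\<lambda>s. exp (- k * s) * h s))) / (2 * k)"

lemma bounded_measurable_const: "bounded_measurable (\<lambda>_. c)"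
  by (auto simp: bounded_measurable_def bounded_iff)

lemma bounded_measurable_diff:
  assumes "bounded_measurable f" "bounded_measurable h"
  shows "bounded_measurable (\<lambda>s. f s - h s)"
  using assms by (auto simp: bounded_measurable_def intro!: bounded_minus_comp)

lemma bounded_measurable_continuous:
  assumes "continuous_on {0..} h" "bounded (h ` {0..})"
  shows "bounded_measurable h"
  using assms by (auto simp: bounded_measurable_def intro!: continuous_imp_measurable_on_sets_lebesgue)

lemma integrable_exp_bounded_half_line:
  assumes "k > 0" "bounded_measurable h"
  shows "(\<lambda>s. exp (- k * s) * h s) integrable_on {0..}"
proof -
  obtain C where C: "\<And>s. s \<ge> 0 \<Longrightarrow> \<bar>h s\<bar> \<le> C"
    using assms(2) by (auto simp: bounded_measurable_def bounded_iff)
  show ?thesis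
  proof (rule measurable_bounded_by_integrable_imp_integrable_real)
    have "(\<lambda>s::real. exp (- k * s)) \<in> borel_measurable (lebesgue_on {0..})"
      by (intro continuous_imp_measurable_on_sets_lebesgue continuous_intros) auto
    then show "(\<lambda>s. exp (- k * s) * h s) \<in> borel_measurable (lebesgue_on {0..})"
      using assms(2) unfolding bounded_measurable_def by (intro borel_measurable_times) auto
    show "(\<lambda>s. exp (- k * s) * C) integrable_on {0..}"
      using has_integral_exp_minus_to_infinity[OF assms(1), of 0]
      by (intro integrable_on_mult_left) auto
  qed (auto simp: abs_mult C)
qed

lemma integrable_exp_bounded_interval:
  assumes "bounded_measurable h"
  shows "(\<lambda>s. exp (a * s) * h s) integrable_on {0..t}"
proof -
  obtain C where C: "\<And>s. s \<ge> 0 \<Longrightarrow> \<bar>h s\<bar> \<le> C"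
    using assms by (auto simp: bounded_measurable_def bounded_iff)
  have h: "h \<in> borel_measurable (lebesgue_on {0..t})"
    using assms by (auto simp: bounded_measurable_def intro: measurable_restrict_mono)
  show ?thesis
  proof (rule measurable_bounded_by_integrable_imp_integrable_real)
    have "(\<lambda>s. exp (a * s)) \<in> borel_measurable (lebesgue_on {0..t})"
      by (intro continuous_imp_measurable_on_sets_lebesgue continuous_intros) auto
    then show "(\<lambda>s. exp (a * s) * h s) \<in> borel_measurable (lebesgue_on {0..t})"
      using h by (intro borel_measurable_times) auto
    show "(\<lambda>s. exp (a * s) * C) integrable_on {0..t}"
      by (intro integrable_continuous_interval continuous_intros)
  qed (auto simp: abs_mult C)
qed

text \<open>Together with \<open>green_mono\<close>, this turns constant bounds on \<open>h\<close>
  into bounds on its Green image.\<close>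

lemma green_const:
  assumes "k > 0" "t \<ge> 0"
  shows "green k (\<lambda>_. c) t = c / k\<^sup>2"
proof -
  have "((\<lambda>s. exp (- k * s) * c) has_integral (exp (- k * 0) / k) * c) {0..}"
    by (intro has_integral_mult_left has_integral_exp_minus_to_infinity assms)
  then have 1: "integral {0..} (\<lambda>s. exp (- k * s) * c) = c / k"
    by (rule integral_unique[THEN trans]) simp
  have "((\<lambda>s. exp (a * s) * c) has_integral (exp (a * t) * c / a - exp (a * 0) * c / a)) {0..t}"
    if "a \<noteq> 0" for a
    using assms that by (intro fundamental_theorem_of_calculus)
      (auto intro!: derivative_eq_intros simp flip: has_real_derivative_iff_has_vector_derivative)
  then have 2: "integral {0..t} (\<lambda>s. exp (a * s) * c) = (exp (a * t) - 1) * c / a"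
    if "a \<noteq> 0" for a
    by (rule integral_unique[THEN trans]) (use that in \<open>simp_all add: field_simps\<close>)
  have e: "exp (k * t) * exp (- (k * t)) = 1"
    by (simp flip: exp_add)
  have k0: "k \<noteq> 0" "- k \<noteq> 0" using assms(1) by auto
  \<comment> \<open>Used with \<open>x = exp (k * t)\<close> for the first bracket of
    \<open>green\<close> and \<open>x = exp (- k * t)\<close> for the second; the outer exponentials
    then cancel.\<close>
  have "c / k + (x - 1) * c / k = x * (c / k)" "c / k - (x - 1) * c / (- k) = x * (c / k)" for x
    using k0(1) by (simp_all add: field_simps)
  then have "green k (\<lambda>_. c) t = 2 * (exp (k * t) * exp (- (k * t))) * (c / k) / (2 * k)"
    unfolding green_def 1 2[OF k0(1)] 2[OF k0(2)] by (simp only: mult_minus_left) simp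
  then show ?thesis
    unfolding e by (simp add: power2_eq_square)
qed

lemma green_diff:
  assumes "k > 0" "bounded_measurable f" "bounded_measurable h"
  shows "green k (\<lambda>s. f s - h s) t = green k f t - green k h t"
proof -
  have 1: "integral {0..} (\<lambda>s. exp (- k * s) * (f s - h s))
      = integral {0..} (\<lambda>s. exp (- k * s) * f s) - integral {0..} (\<lambda>s. exp (- k * s) * h s)"
    using assms unfolding right_diff_distrib
    by (intro Henstock_Kurzweil_Integration.integral_diff integrable_exp_bounded_half_line)
  have 2: "integral {0..t} (\<lambda>s. exp (a * s) * (f s - h s))
      = integral {0..t} (\<lambda>s. exp (a * s) * f s) - integral {0..t} (\<lambda>s. exp (a * s) * h s)" for a
    using assms unfolding right_diff_distrib
    by (intro Henstock_Kurzweil_Integration.integral_diff integrable_exp_bounded_interval)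
  show ?thesis
    unfolding green_def 1 2 by (simp add: algebra_simps diff_divide_distrib add_divide_distrib)
qed

text \<open>For \<open>h\<close> nonnegative on the half-line, the integral over
  \<open>{0..t}\<close> subtracted in the second bracket is at most the one over
  \<open>{0..}\<close>.\<close>

lemma green_nonneg:
  assumes k: "k > 0" and h: "bounded_measurable h" and nonneg: "\<And>s. s \<ge> 0 \<Longrightarrow> h s \<ge> 0"
  shows "green k h t \<ge> 0"
proof -
  have "integral {0..t} (\<lambda>s. exp (- k * s) * h s) \<le> integral {0..} (\<lambda>s. exp (- k * s) * h s)"
    by (rule integral_subset_le)
      (use nonneg integrable_exp_bounded_interval[OF h, of "- k"]
        integrable_exp_bounded_half_line[OF k h] in auto)
  moreover have "integral {0..} (\<lambda>s. exp (- k * s) * h s) \<ge> 0"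
    by (rule integral_nonneg) (use nonneg integrable_exp_bounded_half_line[OF k h] in auto)
  moreover have "integral {0..t} (\<lambda>s. exp (k * s) * h s) \<ge> 0"
    by (rule integral_nonneg) (use nonneg integrable_exp_bounded_interval[OF h] in auto)
  ultimately show ?thesis
    unfolding green_def using k
    by (intro divide_nonneg_pos add_nonneg_nonneg mult_nonneg_nonneg) auto
qed

lemma green_mono:
  assumes "k > 0" "bounded_measurable f" "bounded_measurable h"
    and "\<And>s. s \<ge> 0 \<Longrightarrow> f s \<le> h s"
  shows "green k f t \<le> green k h t"
  using green_nonneg[OF assms(1) bounded_measurable_diff[OF assms(3,2)], of t]
    green_diff[OF assms(1,3,2)] assms(4) by simp

text \<open>The operator gains regularity: this is what later makes the limit of the iteration
  continuous.\<close>

lemma green_continuous: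
  assumes "bounded_measurable h"
  shows "continuous_on {0..} (green k h)"
proof -
  have I: "continuous_on {0..} (\<lambda>t. integral {0..t} (\<lambda>s. exp (a * s) * h s))" for a
    unfolding continuous_on_eq_continuous_within
  proof
    fix t :: real assume "t \<in> {0..}"
    \<comment> \<open>Work on the compact interval \<open>{0..t + 1}\<close>, which agrees with the
      half-line near \<open>t\<close>.\<close>
    then have "continuous (at t within {0..t + 1}) (\<lambda>t. integral {0..t} (\<lambda>s. exp (a * s) * h s))"
      using indefinite_integral_continuous_1[OF integrable_exp_bounded_interval[OF assms, of a "t + 1"]]
      by (simp add: continuous_on_eq_continuous_within)
    moreover have "at t within {0..t + 1} = at t within {0..}"
      by (rule at_within_nhd[of t "{..<t + 1}"]) auto
    ultimately show "continuous (at t within {0..}) (\<lambda>t. integral {0..t} (\<lambda>s. exp (a * s) * h s))"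
      by simp
  qed
  show ?thesis
    unfolding green_def divide_inverse by (intro continuous_intros I)
qed

lemma green_tendsto:
  assumes k: "k > 0" and f: "\<And>n. bounded_measurable (f n)"
    and bd: "\<And>n s. s \<ge> 0 \<Longrightarrow> \<bar>f n s\<bar> \<le> C"
    and lim: "\<And>s. s \<ge> 0 \<Longrightarrow> (\<lambda>n. f n s) \<longlonglongrightarrow> h s"
  shows "(\<lambda>n. green k (f n) t) \<longlonglongrightarrow> green k h t"
proof -
  have 1: "(\<lambda>n. integral {0..} (\<lambda>s. exp (- k * s) * f n s))
      \<longlonglongrightarrow> integral {0..} (\<lambda>s. exp (- k * s) * h s)"
    by (rule dominated_convergence(2)[where h = "\<lambda>s. exp (- k * s) * C"])
      (use integrable_exp_bounded_half_line[OF k] f bounded_measurable_const bd lim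
        in \<open>auto simp: abs_mult intro!: tendsto_intros\<close>)
  have 2: "(\<lambda>n. integral {0..t} (\<lambda>s. exp (a * s) * f n s))
      \<longlonglongrightarrow> integral {0..t} (\<lambda>s. exp (a * s) * h s)" for a
    by (rule dominated_convergence(2)[where h = "\<lambda>s. exp (a * s) * C"])
      (use integrable_exp_bounded_interval f bounded_measurable_const bd lim
        in \<open>auto simp: abs_mult intro!: tendsto_intros\<close>)
  show ?thesis
    unfolding green_def using k by (intro tendsto_intros 1 2) auto
qed

lemma integral_has_real_derivative_half_line:
  fixes f :: "real \<Rightarrow> real"
  assumes "continuous_on {0..} f" "t \<ge> 0"
  shows "((\<lambda>t. integral {0..t} f) has_real_derivative f t) (at t within {0..})"
proof -
  have "((\<lambda>t. integral {0..t} f) has_real_derivative f t) (at t within {0..t + 1})"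
    by (rule integral_has_real_derivative)
      (use assms in \<open>auto intro: continuous_on_subset\<close>)
  moreover have "at t within {0..t + 1} = at t within {0..}"
    by (rule at_within_nhd[of t "{..<t + 1}"]) auto
  ultimately show ?thesis by simp
qed

text \<open>The two summands satisfy the first-order equations A' = -k A + h and B' = k B - h. Hence
  (A + B) / (2 k) has derivative (B - A) / 2, which vanishes at 0 since A and B both start at
  \<open>c\<close>.\<close>

lemma green_solves:
  assumes k: "k > 0" and h: "continuous_on {0..} h"
  shows "\<exists>v. (\<forall>t\<ge>0. (green k h has_real_derivative v t) (at t within {0..})) \<and>
    (\<forall>t\<ge>0. (v has_real_derivative k\<^sup>2 * green k h t - h t) (at t within {0..})) \<and> v 0 = 0"
proof -
  define c where "c = integral {0..} (\<lambda>s. exp (- k * s) * h s)"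
  define A where "A t = exp (- k * t) * (c + integral {0..t} (\<lambda>s. exp (k * s) * h s))" for t
  define B where "B t = exp (k * t) * (c - integral {0..t} (\<lambda>s. exp (- k * s) * h s))" for t
  have green: "green k h = (\<lambda>t. (A t + B t) / (2 * k))"
    by (simp add: fun_eq_iff green_def A_def B_def c_def)
  have I: "((\<lambda>t. integral {0..t} (\<lambda>s. exp (a * s) * h s)) has_real_derivative exp (a * t) * h t)
      (at t within {0..})" if "t \<ge> 0" for a t
    by (intro integral_has_real_derivative_half_line continuous_intros h that)
  have e: "exp (k * t) * exp (- (k * t)) = 1" for t
    by (simp flip: exp_add)
  have A: "(A has_real_derivative - k * A t + h t) (at t within {0..})" if "t \<ge> 0" for t
    unfolding A_def
    by (rule derivative_eq_intros I that refl)+ (use e[of t] in \<open>simp add: algebra_simps\<close>)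
  have B: "(B has_real_derivative k * B t - h t) (at t within {0..})" if "t \<ge> 0" for t
    unfolding B_def
    by (rule derivative_eq_intros I that refl)+ (use e[of t] in \<open>simp add: algebra_simps\<close>)
  have "((\<lambda>t. (A t + B t) / (2 * k)) has_real_derivative (B t - A t) / 2) (at t within {0..})"
    if "t \<ge> 0" for t
    by (rule derivative_eq_intros A B that refl)+ (use k in \<open>simp_all add: field_simps\<close>)
  moreover have "((\<lambda>t. (B t - A t) / 2) has_real_derivative k\<^sup>2 * ((A t + B t) / (2 * k)) - h t)
      (at t within {0..})" if "t \<ge> 0" for t
    by (rule derivative_eq_intros A B that refl)+
      (use k in \<open>simp_all add: field_simps power2_eq_square\<close>)
  moreover have "(B 0 - A 0) / 2 = 0"
    by (simp add: A_def B_def)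
  ultimately show ?thesis
    unfolding green by (intro exI[of _ "\<lambda>t. (B t - A t) / 2"]) auto
qed

section \<open>Existence by monotone iteration\<close>

lemma neumann_solution_bounded_exists:
  assumes g: "continuous_on {0..} g" "bounded (g ` {0..})"
    and eps: "\<epsilon> > 0" and lam: "lam \<le> 0"
  obtains u where "neumann_solution \<epsilon> lam g u" "bounded (u ` {0..})"
proof -
  obtain G where G: "G > 0" "\<And>t. t \<ge> 0 \<Longrightarrow> \<bar>g t\<bar> \<le> G"
    using g(2) unfolding bounded_pos by auto
  \<comment> \<open>As \<open>M \<ge> 1\<close>, the cube of \<open>M\<close> is at least
    \<open>M\<close>, which exceeds the bound \<open>G\<close> of \<open>g\<close>.\<close>
  define M where "M = 1 + G"
  have M: "M \<ge> 1" "M > 0" using G(1) by (auto simp: M_def)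
  \<comment> \<open>The maximum over \<open>[-M, M]\<close> of the derivative of x^3 - lam x; adding
    \<open>K * x\<close> makes \<open>F\<close> nondecreasing there.\<close>
  define K where "K = 3 * M\<^sup>2 - lam"
  have K: "K > 0" using M(2) lam zero_less_power[OF M(2), of 2] unfolding K_def by linarith
  define k where "k = sqrt K / \<epsilon>"
  have k: "k > 0" and k2: "k\<^sup>2 = K / \<epsilon>\<^sup>2"
    using K eps by (auto simp: k_def power_divide)
  define F where "F x = K * x - x ^ 3 + lam * x" for x
  have F_mono: "F x \<le> F y" if "- M \<le> x" "x \<le> y" "y \<le> M" for x y
  proof -
    have "x\<^sup>2 \<le> M\<^sup>2" "y\<^sup>2 \<le> M\<^sup>2"
      using that by (auto intro!: abs_le_square_iff[THEN iffD1])
    moreover have "2 * (x * y) \<le> x\<^sup>2 + y\<^sup>2"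
      using sum_squares_bound[of x y] by simp
    ultimately have "0 \<le> (y - x) * (3 * M\<^sup>2 - (x\<^sup>2 + x * y + y\<^sup>2))"
      using that by (intro mult_nonneg_nonneg) auto
    also have "\<dots> = F y - F x"
      by (simp add: F_def K_def power2_eq_square power3_eq_cube algebra_simps)
    finally show ?thesis by simp
  qed
  have "G \<le> M ^ 3 - lam * M"
  proof -
    have "M \<le> M ^ 3" using M(1) by (simp add: self_le_power)
    moreover have "lam * M \<le> 0" using lam M by (simp add: mult_nonpos_nonneg)
    ultimately show ?thesis by (simp add: M_def)
  qed
  \<comment> \<open>The super- and subsolution inequalities for \<open>M\<close> and
    \<open>- M\<close>; the second follows from the first because \<open>F\<close> is odd.\<close>
  then have F_M: "F M + G \<le> K * M" "- (K * M) \<le> F (- M) - G"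
    by (auto simp: F_def)
  \<comment> \<open>Dividing \<epsilon>^2 v'' = K v - (F(u) - g) by \<epsilon>^2 gives v'' = k^2 v -
    \<open>h u\<close>, the form solved by \<open>green k\<close>.\<close>
  define h where "h u s = (F (u s) - g s) / \<epsilon>\<^sup>2" for u s
  have h_bd: "\<bar>h u s\<bar> \<le> k\<^sup>2 * M" if "\<bar>u s\<bar> \<le> M" "s \<ge> 0" for u s
  proof -
    have "F (- M) \<le> F (u s)" "F (u s) \<le> F M"
      using that by (auto intro!: F_mono)
    then have "\<bar>F (u s) - g s\<bar> \<le> K * M"
      using F_M G(2)[OF that(2)] by linarith
    then show ?thesis
      using eps by (simp add: h_def k2 field_simps)
  qed
  have h_mono: "h u s \<le> h v s" if "- M \<le> u s" "u s \<le> v s" "v s \<le> M" for u v s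
    using F_mono[OF that] by (simp add: h_def divide_right_mono)
  have bm_h: "bounded_measurable (h u)"
    if "u \<in> borel_measurable (lebesgue_on {0..})" "\<And>s. s \<ge> 0 \<Longrightarrow> \<bar>u s\<bar> \<le> M" for u
  proof -
    have "g \<in> borel_measurable (lebesgue_on {0..})"
      using g(1) by (rule continuous_imp_measurable_on_sets_lebesgue) auto
    then have "h u \<in> borel_measurable (lebesgue_on {0..})"
      unfolding h_def[abs_def] F_def using that(1) by measurable
    moreover have "bounded (h u ` {0..})"
      using h_bd that(2) by (auto simp: bounded_iff)
    ultimately show ?thesis by (simp add: bounded_measurable_def)
  qed
  have green_bd: "\<bar>green k f t\<bar> \<le> M"
    if "bounded_measurable f" "\<And>s. s \<ge> 0 \<Longrightarrow> \<bar>f s\<bar> \<le> k\<^sup>2 * M" "t \<ge> 0" for f t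
  proof -
    \<comment> \<open>Comparison with the constants whose Green images are \<open>- M\<close> and
      \<open>M\<close>.\<close>
    have "green k (\<lambda>_. - (k\<^sup>2 * M)) t \<le> green k f t" "green k f t \<le> green k (\<lambda>_. k\<^sup>2 * M) t"
      using abs_le_D1[OF that(2)] minus_le_iff[THEN iffD1, OF abs_le_D2[OF that(2)]]
      by (auto intro: green_mono k that(1) bounded_measurable_const)
    then show ?thesis
      using k by (simp add: green_const[OF k that(3)])
  qed

  define U where "U = rec_nat (\<lambda>_. - M) (\<lambda>_ u. green k (h u))"
  have U_0: "U 0 = (\<lambda>_. - M)" and U_Suc: "U (Suc n) = green k (h (U n))" for n
    by (simp_all add: U_def)
  have U: "U n \<in> borel_measurable (lebesgue_on {0..}) \<and> (\<forall>s\<ge>0. \<bar>U n s\<bar> \<le> M)" for n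
  proof (induction n)
    case 0
    then show ?case using M by (simp add: U_0)
  next
    case (Suc n)
    then have bm: "bounded_measurable (h (U n))" by (intro bm_h) auto
    then have "green k (h (U n)) \<in> borel_measurable (lebesgue_on {0..})"
      by (intro continuous_imp_measurable_on_sets_lebesgue green_continuous) auto
    moreover have "\<bar>green k (h (U n)) s\<bar> \<le> M" if "s \<ge> 0" for s
      using Suc by (intro green_bd bm h_bd that) auto
    ultimately show ?case by (simp add: U_Suc)
  qed
  have bm_hU: "bounded_measurable (h (U n))" for n
    using U by (intro bm_h) auto
  \<comment> \<open>The first step goes up because the iteration starts at the lower bound
    \<open>- M\<close>; monotonicity of \<open>h\<close> and of \<open>green\<close> propagates the
    order.\<close>
  have U_mono: "U n s \<le> U (Suc n) s" if "s \<ge> 0" for n s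
    using that
  proof (induction n arbitrary: s)
    case 0
    then show ?case using U[of "Suc 0"] by (auto simp: U_0 abs_le_iff)
  next
    case (Suc n)
    have "green k (h (U n)) s \<le> green k (h (U (Suc n))) s"
    proof (rule green_mono[OF k bm_hU bm_hU])
      fix r :: real assume "r \<ge> 0"
      then show "h (U n) r \<le> h (U (Suc n)) r"
        using Suc.IH U[of n] U[of "Suc n"] by (intro h_mono) (auto simp: abs_le_iff)
    qed
    then show ?case by (simp add: U_Suc)
  qed
  define u where "u s = lim (\<lambda>n. U n s)" for s
  have U_lim: "(\<lambda>n. U n s) \<longlonglongrightarrow> u s" if "s \<ge> 0" for s
  proof -
    have "convergent (\<lambda>n. U n s)"
    proof (rule Bseq_mono_convergent)
      show "Bseq (\<lambda>n. U n s)"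
        using U that by (intro BseqI'[of _ M]) auto
      show "\<forall>m n. m \<le> n \<longrightarrow> U m s \<le> U n s"
        using lift_Suc_mono_le[of "\<lambda>n. U n s", OF U_mono[OF that]] by blast
    qed
    then show ?thesis by (simp add: u_def convergent_LIMSEQ_iff)
  qed
  have u_bd: "\<bar>u s\<bar> \<le> M" if "s \<ge> 0" for s
    using U that by (intro LIMSEQ_le_const2[OF tendsto_rabs[OF U_lim[OF that]]]) auto
  have "u \<in> borel_measurable (lebesgue_on {0..})"
    by (rule borel_measurable_LIMSEQ_real[of _ U]) (use U U_lim in auto)
  then have bm_hu: "bounded_measurable (h u)"
    using u_bd by (rule bm_h)
  \<comment> \<open>The shifted sequence tends to \<open>u t\<close>, and by dominated convergence
    also to the Green image of \<open>h u\<close>.\<close>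
  have u_fix: "u t = green k (h u) t" if t: "t \<ge> 0" for t
  proof (rule LIMSEQ_unique)
    show "(\<lambda>n. U (Suc n) t) \<longlonglongrightarrow> u t"
      using U_lim[OF t] by (rule LIMSEQ_Suc)
    show "(\<lambda>n. U (Suc n) t) \<longlonglongrightarrow> green k (h u) t"
      unfolding U_Suc
    proof (rule green_tendsto[OF k bm_hU])
      show "\<bar>h (U n) s\<bar> \<le> k\<^sup>2 * M" if "s \<ge> 0" for n s
        using U that by (intro h_bd) auto
      show "(\<lambda>n. h (U n) s) \<longlonglongrightarrow> h u s" if "s \<ge> 0" for s
        unfolding h_def F_def using eps by (intro tendsto_intros U_lim that) auto
    qed
  qed
  \<comment> \<open>Bootstrap: being a Green image makes \<open>u\<close> continuous, hence
    \<open>h u\<close> is continuous and that image is a classical solution.\<close>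
  have "continuous_on {0..} u"
    by (rule continuous_on_eq[OF green_continuous[OF bm_hu, of k]]) (use u_fix in auto)
  then have "continuous_on {0..} (h u)"
    unfolding h_def[abs_def] F_def using eps g(1) by (intro continuous_intros) auto
  from green_solves[OF k this] obtain v where v:
    "\<And>t. t \<ge> 0 \<Longrightarrow> (green k (h u) has_real_derivative v t) (at t within {0..})"
    "\<And>t. t \<ge> 0 \<Longrightarrow> (v has_real_derivative k\<^sup>2 * green k (h u) t - h u t) (at t within {0..})"
    "v 0 = 0" by blast
  have "(u has_real_derivative v t) (at t within {0..})" if "t \<ge> 0" for t
    by (rule has_field_derivative_transform_within[OF v(1)[OF that] zero_less_one]) (use that u_fix in auto)
  moreover have "\<epsilon>\<^sup>2 * (k\<^sup>2 * green k (h u) t - h u t) = u t ^ 3 - lam * u t + g t" if "t \<ge> 0" for t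
    using eps by (simp add: u_fix[OF that, symmetric] k2 h_def F_def field_simps)
  ultimately have "neumann_solution \<epsilon> lam g u"
    unfolding neumann_solution_def using v(2,3)
    by (intro exI[of _ v] exI[of _ "\<lambda>t. k\<^sup>2 * green k (h u) t - h u t"] conjI allI impI)
  moreover have "bounded (u ` {0..})"
    using u_bd by (auto simp: bounded_iff)
  ultimately show thesis by (rule that)
qed

section \<open>Unique existence on the half-line\<close>

text \<open>Allows the solution to be replaced by its restriction: the equation leaves the values at
  negative times free, and \<open>extensional\<close> fixes them so that uniqueness is equality of
  functions.\<close>

lemma neumann_solution_cong:
  assumes eq: "\<And>t. t \<ge> 0 \<Longrightarrow> y t = u t" and u: "neumann_solution \<epsilon> lam g u"
  shows "neumann_solution \<epsilon> lam g y"
proof -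
  obtain v w where vw:
    "\<And>t. t \<ge> 0 \<Longrightarrow> (u has_real_derivative v t) (at t within {0..})"
    "\<And>t. t \<ge> 0 \<Longrightarrow> (v has_real_derivative w t) (at t within {0..})"
    "\<And>t. t \<ge> 0 \<Longrightarrow> \<epsilon>\<^sup>2 * w t = (u t) ^ 3 - lam * u t + g t" "v 0 = 0"
    using u unfolding neumann_solution_def by blast
  have "(y has_real_derivative v t) (at t within {0..})" if "t \<ge> 0" for t
    by (rule has_field_derivative_transform_within[OF vw(1)[OF that] zero_less_one])
      (use eq that in auto)
  then show ?thesis
    unfolding neumann_solution_def using vw(2-4) eq
    by (intro exI[of _ v] exI[of _ w] conjI allI impI) simp_all
qed

theorem proposition2:
  fixes g :: "real \<Rightarrow> real" and \<epsilon> lam :: real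
  assumes "continuous_on {0..} g"
    and "bounded (g ` {0..})"
    and "\<epsilon> > 0"
    and "lam \<le> 0"
  shows "\<exists>!u. u \<in> extensional {0..} \<and> neumann_solution \<epsilon> lam g u \<and> bounded (u ` {0..})"
proof (rule ex_ex1I)
  obtain u where u: "neumann_solution \<epsilon> lam g u" "bounded (u ` {0..})"
    using neumann_solution_bounded_exists[OF assms] .
  have "neumann_solution \<epsilon> lam g (restrict u {0..})"
    by (rule neumann_solution_cong[OF _ u(1)]) simp
  moreover have "restrict u {0..} ` {0..} = u ` {0..}"
    by auto
  ultimately show "\<exists>u. u \<in> extensional {0..} \<and> neumann_solution \<epsilon> lam g u \<and> bounded (u ` {0..})"
    using u(2) by (intro exI[of _ "restrict u {0..}"]) auto
next
  fix u y
  assume "u \<in> extensional {0..} \<and> neumann_solution \<epsilon> lam g u \<and> bounded (u ` {0..})"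
    and "y \<in> extensional {0..} \<and> neumann_solution \<epsilon> lam g y \<and> bounded (y ` {0..})"
  then show "u = y"
    using neumann_solution_bounded_unique[OF assms(3,4)] by (auto intro: extensionalityI)
qed

end
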